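(* Let $\gamma>0$ and let $\mathcal Z\subseteq\mathbb R^d$ be a nonempty compact convex set. Then, for every $\bm y_0\in\mathbb R^d$, the objective of the problem $\min_{\bm z\in\mathcal Z}\ \bm y_0^\top\bm z+\frac\gamma2\|\bm z\|_2^2$ is strongly convex in $\bm z$, so the problem admits a unique minimizer $\bm z^\star_\gamma(\bm y_0)$. Moreover, $$\bm z^\star_\gamma(\bm y_0)=\Pi_{\mathcal Z}\Big(-\frac{\bm y_0}{\gamma}\Big),$$ where $\Pi_{\mathcal Z}$ denotes the Euclidean projection onto $\mathcal Z$. Thus, $\bm z^\star_\gamma(\cdot)$ is Lipschitz continuous with constant $1/\gamma$ and differentiable almost everywhere.
   Context: Lipschitz continuity is with respect to the Euclidean norm; "almost everywhere" is with respect to Lebesgue measure on $\mathbb R^d$. *)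

theory Defs
  imports "HOL-Analysis.Analysis"
begin

text \<open>Strong convexity with respect to the norm, for an unspecified modulus \<open>\<mu> > 0\<close>.\<close>

definition strongly_convex_on :: "'a::real_normed_vector set \<Rightarrow> ('a \<Rightarrow> real) \<Rightarrow> bool" where
  "strongly_convex_on S f \<longleftrightarrow> convex S \<and>
     (\<exists>\<mu>>0. \<forall>x\<in>S. \<forall>y\<in>S. \<forall>t\<in>{0..1}.
        f ((1 - t) *\<^sub>R x + t *\<^sub>R y)
          \<le> (1 - t) * f x + t * f y - \<mu> / 2 * t * (1 - t) * (norm (x - y))\<^sup>2)"

definition reg_objective :: "real \<Rightarrow> real ^ 'd \<Rightarrow> real ^ 'd \<Rightarrow> real" where
  "reg_objective \<gamma> y\<^sub>0 z = y\<^sub>0 \<bullet> z + \<gamma> / 2 * (norm z)\<^sup>2"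

text \<open>\<open>arg_min_on\<close> chooses some minimizer by Hilbert choice, so \<open>reg_minimizer\<close> is the minimizer
  only when exactly one exists.\<close>

definition reg_minimizer :: "real \<Rightarrow> (real ^ 'd) set \<Rightarrow> real ^ 'd \<Rightarrow> real ^ 'd" where
  "reg_minimizer \<gamma> Z y\<^sub>0 = arg_min_on (reg_objective \<gamma> y\<^sub>0) Z"

end

theory Submission
  imports Defs
begin

text \<open>Completing the square turns the objective into \<open>\<gamma> / 2\<close> times the squared distance to \<open>- y\<^sub>0 / \<gamma>\<close>
  plus a constant, so the minimizer is a projection, hence \<open>1 / \<gamma>\<close>-Lipschitz, and Rademacher's
  theorem gives differentiability almost everywhere.

  Rademacher's theorem is proved in the manner of Nekvinda and Zajicek. On the line, \<open>f\<close> plus a steep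
  linear function is an expanding homeomorphism; the Lebesgue measure of images under it is absolutely
  continuous, so \<open>f\<close> is an indefinite integral. In higher dimension this gives, for almost every \<open>x\<close>
  and every \<open>\<epsilon> > 0\<close>, membership of \<open>x\<close> in one of countably many closed sets on which \<open>f\<close> is
  \<open>\<epsilon>\<close>-close to one fixed linear map along all coordinate directions, at a fixed scale. By a Vitali
  covering argument, the points at which such a set is porous form a null set. From a non-porous point,
  \<open>f\<close> is estimated along a coordinate path, moving to a nearby point of the set at each corner.\<close>

subsection \<open>Lipschitz functions on the line\<close>

text \<open>The Lebesgue differentiation theorem in the form applied here controls averages over
  intervals to the right of a point. Applied also to the reflected integrand \<open>g (- u)\<close>
  at \<open>- x\<close>, it controls averages to the left of \<open>x\<close>. The exceptional
  points lie in \<open>N1\<close> together with the reflection of \<open>N2\<close>.\<close>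

lemma indefinite_integral_has_real_derivative_AE:
  fixes F g :: "real \<Rightarrow> real"
  assumes F: "\<And>a b. a \<le> b \<Longrightarrow> (g has_integral F b - F a) {a..b}"
  shows "AE x in lebesgue. (F has_real_derivative g x) (at x)"
proof -
  have int: "g integrable_on cbox a b" for a b
    using F[of a b] by (cases "a \<le> b") (auto simp: integrable_on_def)
  have int': "(\<lambda>u. g (- u)) integrable_on cbox a b" for a b
    using int[of "-b" "-a"]
      Henstock_Kurzweil_Integration.integrable_reflect_real[where f=g and a="-b" and b="-a"]
    by (simp add: cbox_interval)
  obtain N1 where N1: "negligible N1" "\<And>x e. \<lbrakk>x \<notin> N1; 0 < e\<rbrakk> \<Longrightarrow>
      \<exists>d>0. \<forall>h. 0 < h \<and> h < d \<longrightarrow>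
        norm (integral (cbox x (x + h *\<^sub>R One)) g /\<^sub>R h ^ DIM(real) - g x) < e"
    using integrable_ccontinuous_explicit[OF int] by blast
  obtain N2 where N2: "negligible N2" "\<And>x e. \<lbrakk>x \<notin> N2; 0 < e\<rbrakk> \<Longrightarrow>
      \<exists>d>0. \<forall>h. 0 < h \<and> h < d \<longrightarrow>
        norm (integral (cbox x (x + h *\<^sub>R One)) (\<lambda>u. g (- u)) /\<^sub>R h ^ DIM(real) - g (- x)) < e"
    using integrable_ccontinuous_explicit[OF int'] by blast
  have deriv: "(F has_real_derivative g x) (at x)" if x: "x \<notin> N1" "- x \<notin> N2" for x
    unfolding DERIV_def LIM_def
  proof (intro allI impI)
    fix e :: real assume e: "e > 0"
    obtain d1 where d1: "d1 > 0" "\<And>h. 0 < h \<and> h < d1 \<Longrightarrow>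
        norm (integral (cbox x (x + h *\<^sub>R One)) g /\<^sub>R h ^ DIM(real) - g x) < e"
      using N1(2)[OF x(1) e] by blast
    obtain d2 where d2: "d2 > 0" "\<And>h. 0 < h \<and> h < d2 \<Longrightarrow>
        norm (integral (cbox (- x) (- x + h *\<^sub>R One)) (\<lambda>u. g (- u)) /\<^sub>R h ^ DIM(real)
          - g (- (- x))) < e"
      using N2(2)[OF x(2) e] by blast
    show "\<exists>d>0. \<forall>h. h \<noteq> 0 \<and> dist h 0 < d \<longrightarrow> dist ((F (x + h) - F x) / h) (g x) < e"
    proof (intro exI[of _ "min d1 d2"] conjI allI impI)
      fix h :: real assume h: "h \<noteq> 0 \<and> dist h 0 < min d1 d2"
      show "dist ((F (x + h) - F x) / h) (g x) < e"
      proof (cases "h > 0")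
        case True
        have "integral {x..x + h} g = F (x + h) - F x"
          using F[of x "x + h"] True by (intro integral_unique) auto
        then show ?thesis
          using d1(2)[of h] h True by (simp add: dist_norm field_simps)
      next
        case False
        have "integral {- x..- (x + h)} (\<lambda>u. g (- u)) = integral {x + h..x} g"
          by (rule Henstock_Kurzweil_Integration.integral_reflect_real)
        also have "\<dots> = F x - F (x + h)"
          using F[of "x + h" x] False by (intro integral_unique) auto
        finally have "\<bar>inverse (- h) * (F x - F (x + h)) - g x\<bar> < e"
          using d2(2)[of "- h"] h False by simp
        moreover have "inverse (- h) * (F x - F (x + h)) = (F (x + h) - F x) / h"
          using h by (simp add: field_simps)
        ultimately show ?thesis
          by (simp add: dist_real_def)
      qed
    qed (use d1 d2 in auto)
  qed
  have "negligible (N1 \<union> uminus ` N2)"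
    using N1(1) N2(1)
    by (intro negligible_Un negligible_differentiable_image_negligible)
       (auto intro: derivative_intros)
  moreover have "{x. \<not> (F has_real_derivative g x) (at x)} \<subseteq> N1 \<union> uminus ` N2"
    using deriv by (force simp: image_iff)
  ultimately show ?thesis
    by (intro AE_I'[of "N1 \<union> uminus ` N2"]) (auto simp: negligible_iff_null_sets)
qed

lemma expanding_lipschitz_indefinite_integral:
  fixes F :: "real \<Rightarrow> real"
  assumes lip: "C-lipschitz_on UNIV F"
    and exp: "\<And>x y. x \<le> y \<Longrightarrow> y - x \<le> F y - F x"
  obtains g where "\<And>a b. a \<le> b \<Longrightarrow> (g has_integral F b - F a) {a..b}"
proof -
  have cont: "continuous_on A F" for A
    using lipschitz_on_continuous_on[OF lip] continuous_on_subset by blast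
  have strict: "F x < F y \<longleftrightarrow> x < y" for x y
    using exp[of x y] exp[of y x] by linarith
  then have inj: "inj F"
    by (metis injI linorder_neqE order_less_irrefl)
  have surj: "surj F"
  proof -
    have "y \<in> range F" for y
    proof -
      \<comment> \<open>By expansion, moving a distance \<open>r\<close> from 0 changes
        \<open>F\<close> by at least \<open>r\<close>, which is enough to bracket
        \<open>y\<close>.\<close>
      define r where "r = \<bar>y - F 0\<bar>"
      have "F (- r) \<le> y" "y \<le> F r" "- r \<le> r"
        using exp[of "- r" 0] exp[of 0 r] by (auto simp: r_def)
      then show ?thesis
        using IVT'[of F "- r" y r] cont by auto
    qed
    then show ?thesis by auto
  qed
  define G where "G = inv F"
  have FG [simp]: "F (G y) = y" and GF [simp]: "G (F x) = x" for x y
    by (simp_all add: G_def surj_f_inv_f[OF surj] inv_f_f[OF inj])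
  have Gle: "G y \<le> b \<longleftrightarrow> y \<le> F b" and leG: "a \<le> G y \<longleftrightarrow> F a \<le> y" for a b y
    using strict[of b "G y"] strict[of "G y" a] by (simp_all add: not_less[symmetric])
  have strictG: "G x < G y \<longleftrightarrow> x < y" for x y
    using strict[of "G x" "G y"] by simp
  have "mono G"
    using strictG by (metis monoI not_le)
  then have G_meas [measurable]: "G \<in> borel_measurable borel"
    by (rule borel_measurable_mono)
  have vim: "G -` A = F ` A" for A :: "real set"
  proof -
    have "y \<in> F ` A" if "G y \<in> A" for y
      using imageI[OF that, of F] by simp
    then show ?thesis by auto
  qed
  define M where "M = distr lborel borel G"
  have sets_M: "sets M = sets lborel"
    by (simp add: M_def)
  have em: "emeasure M A = emeasure lborel (F ` A)" if "A \<in> sets borel" for A :: "real set"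
    using that by (simp add: M_def emeasure_distr vim)
  have ac: "absolutely_continuous lborel M"
    unfolding absolutely_continuous_def
  proof
    fix A :: "real set" assume A: "A \<in> null_sets lborel"
    then have Ab: "A \<in> sets borel" by auto
    have "negligible A"
      using A by (simp add: negligible_iff_null_sets null_sets_completionI)
    then have "negligible (F ` A)"
    proof (rule negligible_locally_Lipschitz_image[rotated])
      show "\<exists>T B. open T \<and> x \<in> T \<and> (\<forall>y\<in>A \<inter> T. norm (F y - F x) \<le> B * norm (y - x))" for x
        using lipschitz_onD[OF lip] by (intro exI[of _ UNIV] exI[of _ C]) (auto simp: dist_norm)
    qed simp
    moreover have "F ` A \<in> sets borel"
      using measurable_sets[OF G_meas Ab] by (simp add: vim)
    ultimately have "emeasure lborel (F ` A) = 0"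
      by (simp add: negligible_iff_emeasure0 )
    then show "A \<in> null_sets M"
      using Ab by (simp add: em null_sets_def sets_M)
  qed
  obtain g where g: "g \<in> borel_measurable lborel" "density lborel g = M"
    using sigma_finite_measure.Radon_Nikodym[OF sigma_finite_lborel ac sets_M] by blast
  have g_meas [measurable]: "g \<in> borel_measurable borel"
    using g(1) by simp
  have gint: "(\<integral>\<^sup>+x. g x * indicator {a..b} x \<partial>lborel) = ennreal (F b - F a)" if "a \<le> b" for a b
  proof -
    have "F ` {a..b} = {F a..F b}"
    proof -
      have "F ` {a..b} = G -` {a..b}" by (simp add: vim)
      also have "\<dots> = {F a..F b}"
        by (simp add: set_eq_iff Gle leG)
      finally show ?thesis .
    qed
    moreover have "F a \<le> F b" using exp[OF that] that by simp
    moreover have "(\<integral>\<^sup>+x. g x * indicator {a..b} x \<partial>lborel) = emeasure M {a..b}"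
      by (simp add: g(2)[symmetric] emeasure_density)
    ultimately show ?thesis
      by (simp add: em)
  qed
  \<comment> \<open>The density takes values in the extended reals. Its integral over every bounded
    interval is finite, so it is finite almost everywhere and \<open>enn2real\<close> preserves its
    integrals.\<close>
  have "AE x in lborel. \<forall>n::nat. g x * indicator {- real n..real n} x \<noteq> \<infinity>"
    unfolding AE_all_countable by (intro allI nn_integral_PInf_AE) (auto simp: gint)
  then have fin: "AE x in lborel. g x \<noteq> \<infinity>"
  proof (rule AE_mp, intro AE_I2 impI)
    fix x assume *: "\<forall>n::nat. g x * indicator {- real n..real n} x \<noteq> \<infinity>"
    obtain n :: nat where "\<bar>x\<bar> \<le> real n" using real_arch_simple by blast
    then show "g x \<noteq> \<infinity>"
      using *[rule_format, of n] by (simp add: indicator_def abs_le_iff split: if_splits)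
  qed
  have "((\<lambda>x. enn2real (g x)) has_integral F b - F a) {a..b}" if "a \<le> b" for a b
  proof -
    have "(\<integral>\<^sup>+x. ennreal (indicator {a..b} x * enn2real (g x)) \<partial>lborel) = ennreal (F b - F a)"
      unfolding gint[OF that, symmetric]
    proof (rule nn_integral_cong_AE, use fin in eventually_elim)
      case (elim x)
      then show ?case
        by (cases "g x") (auto simp: indicator_def)
    qed
    then have "((\<lambda>x. indicator {a..b} x * enn2real (g x)) has_integral F b - F a) UNIV"
      using exp[OF that] that by (intro nn_integral_has_integral) auto
    moreover have "(\<lambda>x. indicator {a..b} x * enn2real (g x))
        = (\<lambda>x. if x \<in> {a..b} then enn2real (g x) else 0)"
      by (auto simp: indicator_def)
    ultimately show ?thesis
      by (simp only: has_integral_restrict_UNIV)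
  qed
  then show ?thesis using that by blast
qed

text \<open>All slopes of \<open>f\<close> are at least \<open>- C\<close>, so adding the linear
  function of slope \<open>C + 1\<close> raises them to at least 1. Subtracting that function again
  preserves differentiability.\<close>

lemma lipschitz_AE_differentiable_real:
  fixes f :: "real \<Rightarrow> real"
  assumes lip: "C-lipschitz_on UNIV f"
  shows "AE x in lebesgue. f differentiable (at x)"
proof -
  have C: "\<bar>f y - f x\<bar> \<le> C * \<bar>y - x\<bar>" for x y
    using lipschitz_onD[OF lip, of y x] by (simp add: dist_real_def)
  have Fl: "(C + \<bar>C + 1\<bar> * 1)-lipschitz_on UNIV (\<lambda>x. f x + (C + 1) *\<^sub>R x)"
    by (intro lipschitz_intros lip)
  have "y - x \<le> (f y + (C + 1) *\<^sub>R y) - (f x + (C + 1) *\<^sub>R x)" if "x \<le> y" for x y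
    using C[of x y] that by (simp add: algebra_simps abs_le_iff)
  then obtain g where "\<And>a b. a \<le> b \<Longrightarrow>
      (g has_integral (f b + (C + 1) *\<^sub>R b) - (f a + (C + 1) *\<^sub>R a)) {a..b}"
    using expanding_lipschitz_indefinite_integral[OF Fl] by metis
  then have "AE x in lebesgue. ((\<lambda>x. f x + (C + 1) *\<^sub>R x) has_real_derivative g x) (at x)"
    by (rule indefinite_integral_has_real_derivative_AE)
  then show ?thesis
  proof eventually_elim
    case (elim x)
    then have "((\<lambda>x. f x + (C + 1) *\<^sub>R x - (C + 1) * x) has_real_derivative g x - (C + 1)) (at x)"
      by (rule derivative_eq_intros) (auto intro!: derivative_eq_intros)
    then show ?case
      by (auto simp: real_differentiable_def)
  qed
qed

subsection \<open>Null sets\<close>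

text \<open>Fubini is applied to the product of the whole space with the parameter line, so no
  splitting into \<open>v\<close> and a complement occurs. Exchanging the quantifiers yields a
  single \<open>t\<close> such that \<open>P (x + t *\<^sub>R v)\<close> holds for almost every
  \<open>x\<close>, and translation invariance removes the shift.\<close>

lemma AE_lborel_if_AE_lines:
  fixes v :: "'a::euclidean_space"
  assumes [measurable]: "Measurable.pred borel P"
    and lines: "\<And>x. AE t in lborel. P (x + t *\<^sub>R v)"
  shows "AE x in lborel. P x"
proof -
  have "AE x in lborel. AE t in (lborel :: real measure). P (x + t *\<^sub>R v)"
    using lines by simp
  then have "AE t in (lborel :: real measure). AE x in lborel. P (x + t *\<^sub>R v)"
    by (subst (asm) lborel_pair.AE_commute) measurable
  moreover have "ae_filter (lborel :: real measure) \<noteq> bot"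
    by (simp add: ae_filter_eq_bot_iff)
  ultimately obtain t :: real where "AE x in lborel. P (x + t *\<^sub>R v)"
    using eventually_happens by blast
  then have "AE x in distr lborel borel ((+) (t *\<^sub>R v)). P x"
    by (subst AE_distr_iff) (auto simp: add.commute)
  then show ?thesis
    unfolding lborel_distr_plus .
qed

text \<open>Choose an open \<open>V\<close> around \<open>S\<close> with \<open>V - S\<close> of
  measure below \<open>e * c ^ ?n\<close>. Vitali gives disjoint balls inside \<open>V\<close> that
  cover almost all of \<open>T\<close>. Each contains a hole of relative volume
  \<open>c ^ ?n\<close> lying in \<open>V - S\<close>. The holes are disjoint, so their total volume
  is below \<open>e * c ^ ?n\<close>, and that of the balls is at most \<open>e\<close>.\<close>

lemma negligible_porous:
  fixes S T :: "'a::euclidean_space set"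
  assumes S: "S \<in> sets lebesgue" and "T \<subseteq> S" and "c > 0"
    and hole: "\<And>x e. \<lbrakk>x \<in> T; e > 0\<rbrakk> \<Longrightarrow>
      \<exists>r w. 0 < r \<and> r < e \<and> ball w (c * r) \<subseteq> ball x r - S"
  shows "negligible T"
  unfolding negligible_outer_le
proof (intro allI impI)
  fix e :: real assume "e > 0"
  let ?n = "DIM('a)"
  let ?\<mu> = "measure lebesgue :: 'a set \<Rightarrow> real"
  obtain V where V: "open V" "S \<subseteq> V" "V - S \<in> lmeasurable"
      "emeasure lebesgue (V - S) < ennreal (e * c ^ ?n)"
    using sets_lebesgue_outer_open[OF S, of "e * c ^ ?n"] \<open>e > 0\<close> \<open>c > 0\<close> by auto
  then have small: "?\<mu> (V - S) \<le> e * c ^ ?n"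
    by (subst (asm) emeasure_eq_ennreal_measure)
       (auto simp: fmeasurable_def less_top \<open>e > 0\<close> \<open>c > 0\<close> ennreal_less_iff)
  \<comment> \<open>A pair encodes a ball by centre and radius; the admissible balls lie in
    \<open>V\<close> and contain a hole.\<close>
  define K where "K = {p. 0 < snd p \<and> ball (fst p) (snd p) \<subseteq> V \<and>
      (\<exists>w. ball w (c * snd p) \<subseteq> ball (fst p) (snd p) - S)}"
  obtain C where C: "countable C" "C \<subseteq> K"
      "pairwise (\<lambda>i j. disjnt (ball (fst i) (snd i)) (ball (fst j) (snd j))) C"
      "negligible (T - (\<Union>i\<in>C. ball (fst i) (snd i)))"
  proof (rule Vitali_covering_theorem_balls[of T K fst snd])
    fix x and d :: real assume x: "x \<in> T" "0 < d"
    then obtain k where k: "k > 0" "ball x k \<subseteq> V"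
      using V \<open>T \<subseteq> S\<close> by (meson openE subsetD)
    obtain r w where "0 < r" "r < min d k" "ball w (c * r) \<subseteq> ball x r - S"
      using hole[of x "min d k"] x k by auto
    moreover from this have "ball x r \<subseteq> V"
      using k by (meson less_imp_le min_less_iff_conj subset_ball subset_trans)
    ultimately show "\<exists>i. i \<in> K \<and> x \<in> ball (fst i) (snd i) \<and> snd i < d"
      by (intro exI[of _ "(x, r)"]) (auto simp: K_def)
  qed blast
  have "\<forall>i\<in>C. \<exists>w. ball w (c * snd i) \<subseteq> ball (fst i) (snd i) - S"
    using C(2) by (auto simp: K_def)
  then obtain w where w: "\<And>i. i \<in> C \<Longrightarrow> ball (w i) (c * snd i) \<subseteq> ball (fst i) (snd i) - S"
    by metis
  \<comment> \<open>A bound uniform over finite subfamilies passes to the countable union.\<close>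
  have fin: "?\<mu> (\<Union>i\<in>I. ball (fst i) (snd i)) \<le> e" if I: "I \<subseteq> C" "finite I" for I
  proof -
    have disj: "pairwise (\<lambda>i j. disjnt (ball (fst i) (snd i)) (ball (fst j) (snd j))) I"
      using C(3) I(1) by (rule pairwise_subset)
    have disj': "pairwise (\<lambda>i j. disjnt (ball (w i) (c * snd i)) (ball (w j) (c * snd j))) I"
      using disj w I(1) unfolding pairwise_def disjnt_def by blast
    have scale: "?\<mu> (ball (w i) (c * snd i)) = c ^ ?n * ?\<mu> (ball (fst i) (snd i))" if "i \<in> I" for i
    proof -
      have "0 < snd i" using that I C(2) by (auto simp: K_def)
      then show ?thesis
        using \<open>c > 0\<close> by (simp add: content_ball_conv_unit_ball[of "c * snd i"]
            content_ball_conv_unit_ball[of "snd i"] power_mult_distrib)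
    qed
    have "c ^ ?n * ?\<mu> (\<Union>i\<in>I. ball (fst i) (snd i)) = (\<Sum>i\<in>I. c ^ ?n * ?\<mu> (ball (fst i) (snd i)))"
      using I disj by (subst measure_UNION') (auto simp: sum_distrib_left)
    also have "\<dots> = ?\<mu> (\<Union>i\<in>I. ball (w i) (c * snd i))"
      using I disj' scale by (subst measure_UNION') auto
    also have "\<dots> \<le> ?\<mu> (V - S)"
    proof (rule measure_mono_fmeasurable)
      show "(\<Union>i\<in>I. ball (w i) (c * snd i)) \<subseteq> V - S"
        using w I(1) C(2) unfolding K_def by blast
    qed (use V I in auto)
    finally have "c ^ ?n * ?\<mu> (\<Union>i\<in>I. ball (fst i) (snd i)) \<le> c ^ ?n * e"
      using small by (simp add: mult.commute)
    then show ?thesis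
      using \<open>c > 0\<close> by simp
  qed
  let ?U = "\<Union>i\<in>C. ball (fst i) (snd i)"
  have U: "?U \<in> lmeasurable" "?\<mu> ?U \<le> e"
    using fin by (auto intro!: fmeasurable_UN_bound[OF C(1)] measure_UN_bound[OF C(1)])
  show "\<exists>A. T \<subseteq> A \<and> A \<in> lmeasurable \<and> ?\<mu> A \<le> e"
  proof (intro exI conjI)
    have "?\<mu> ((T - ?U) \<union> ?U) \<le> ?\<mu> (T - ?U) + ?\<mu> ?U"
      using U C(4) by (intro measure_Un_le) (auto simp: negligible_imp_sets)
    then show "?\<mu> ((T - ?U) \<union> ?U) \<le> e"
      using U(2) C(4) by (simp add: negligible_imp_measure0)
    show "(T - ?U) \<union> ?U \<in> lmeasurable"
      using U(1) C(4) by (intro fmeasurable.Un) (auto simp: negligible_imp_measurable)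
  qed auto
qed

text \<open>If the conclusion fails at \<open>x\<close>, there are arbitrarily short
  \<open>y\<close> for which the ball of radius \<open>\<eta> * norm y\<close> about
  \<open>x + y\<close> misses \<open>S\<close>. This ball lies in the ball of radius
  \<open>(1 + \<eta>) * norm y\<close> about \<open>x\<close>, so \<open>S\<close> is porous at
  \<open>x\<close> with ratio \<open>\<eta> / (1 + \<eta>)\<close>.\<close>

lemma closed_AE_nearby_points:
  fixes S :: "'a::euclidean_space set"
  assumes "closed S" and "\<eta> > 0"
  shows "AE x in lebesgue. x \<in> S \<longrightarrow>
    (\<exists>\<rho>>0. \<forall>y. norm y < \<rho> \<longrightarrow> (\<exists>z\<in>S. dist (x + y) z \<le> \<eta> * norm y))"
proof -
  define T where "T = {x \<in> S. \<not> (\<exists>\<rho>>0. \<forall>y. norm y < \<rho> \<longrightarrow> (\<exists>z\<in>S. dist (x + y) z \<le> \<eta> * norm y))}"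
  have "negligible T"
  proof (rule negligible_porous[of S T "\<eta> / (1 + \<eta>)"])
    fix x and e :: real assume x: "x \<in> T" and "e > 0"
    then have "\<exists>y. norm y < e / (1 + \<eta>) \<and> (\<forall>z\<in>S. dist (x + y) z > \<eta> * norm y)"
      using \<open>\<eta> > 0\<close> unfolding T_def by (force simp: not_le)
    then obtain y where y: "norm y < e / (1 + \<eta>)" "\<And>z. z \<in> S \<Longrightarrow> dist (x + y) z > \<eta> * norm y"
      by blast
    \<comment> \<open>For \<open>y = 0\<close> the point \<open>x\<close> of \<open>S\<close> itself
      would be at distance 0.\<close>
    have "y \<noteq> 0"
      using y(2)[of x] x by (auto simp: T_def)
    have "ball (x + y) (\<eta> * norm y) \<subseteq> ball x ((1 + \<eta>) * norm y) - S"
    proof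
      fix z assume z: "z \<in> ball (x + y) (\<eta> * norm y)"
      have "dist x z \<le> dist x (x + y) + dist (x + y) z"
        by (rule dist_triangle)
      then show "z \<in> ball x ((1 + \<eta>) * norm y) - S"
        using z y(2)[of z] by (auto simp: algebra_simps dist_norm)
    qed
    moreover have "0 < (1 + \<eta>) * norm y" "(1 + \<eta>) * norm y < e"
        "\<eta> / (1 + \<eta>) * ((1 + \<eta>) * norm y) = \<eta> * norm y"
      using \<open>\<eta> > 0\<close> y(1) \<open>y \<noteq> 0\<close> by (auto simp: field_simps intro!: add_pos_pos)
    ultimately show "\<exists>r w. 0 < r \<and> r < e \<and> ball w (\<eta> / (1 + \<eta>) * r) \<subseteq> ball x r - S"
      by (metis (no_types))
  qed (use assms in \<open>auto simp: T_def borel_closed\<close>)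
  then show ?thesis
    by (intro AE_I'[of T]) (auto simp: negligible_iff_null_sets T_def)
qed

subsection \<open>Rademacher's theorem\<close>

text \<open>The vector \<open>a\<close> may change with the tolerance \<open>e\<close>. Two such
  vectors both describe \<open>f\<close> near \<open>x\<close>, so they differ by at most the sum of
  their tolerances. Along tolerances tending to 0 they form a Cauchy sequence, whose limit is the
  gradient.\<close>

lemma differentiable_if_approx_linear:
  fixes f :: "'a::euclidean_space \<Rightarrow> real"
  assumes approx: "\<And>e. e > 0 \<Longrightarrow>
    \<exists>a. \<exists>\<rho>>0. \<forall>y. norm y < \<rho> \<longrightarrow> \<bar>f (x + y) - f x - a \<bullet> y\<bar> \<le> e * norm y"
  shows "f differentiable (at x)"
proof -
  have "\<forall>n. \<exists>a. \<exists>\<rho>>0. \<forall>y. norm y < \<rho> \<longrightarrow>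
      \<bar>f (x + y) - f x - a \<bullet> y\<bar> \<le> inverse (real (Suc n)) * norm y"
    using approx by simp
  then obtain a \<rho> where \<rho>: "\<And>n. \<rho> n > 0" and a: "\<And>n y. norm y < \<rho> n \<Longrightarrow>
      \<bar>f (x + y) - f x - a n \<bullet> y\<bar> \<le> inverse (real (Suc n)) * norm y"
    by metis
  have near: "norm (a m - a n) \<le> inverse (real (Suc m)) + inverse (real (Suc n))" for m n
  proof (cases "a m = a n")
    case False
    \<comment> \<open>The test vector \<open>y\<close> is parallel to \<open>a m - a n\<close>,
      where Cauchy-Schwarz is an equality, and is scaled to lie within both radii.\<close>
    define s where "s = min (\<rho> m) (\<rho> n) / (2 * norm (a m - a n))"
    define y where "y = s *\<^sub>R (a m - a n)"
    have "s > 0"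
      using False \<rho> by (simp add: s_def)
    have norm_y: "norm y = min (\<rho> m) (\<rho> n) / 2"
      using False \<rho>[of m] \<rho>[of n] by (simp add: y_def s_def)
    have "\<bar>(a m - a n) \<bullet> y\<bar> \<le> inverse (real (Suc m)) * norm y + inverse (real (Suc n)) * norm y"
    proof -
      have "norm y < \<rho> m" "norm y < \<rho> n"
        using norm_y \<rho>[of m] \<rho>[of n] by linarith+
      then show ?thesis
        using a[of y m] a[of y n] unfolding inner_diff_left by linarith
    qed
    moreover have "\<bar>(a m - a n) \<bullet> y\<bar> = norm (a m - a n) * norm y"
      using \<open>s > 0\<close> by (simp add: y_def dot_square_norm power2_eq_square)
    ultimately have "norm (a m - a n) * norm y
        \<le> (inverse (real (Suc m)) + inverse (real (Suc n))) * norm y"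
      by (simp add: distrib_right)
    then show ?thesis
      using norm_y \<rho>[of m] \<rho>[of n] by (simp del: of_nat_Suc)
  qed simp
  have "Cauchy a"
  proof (rule metric_CauchyI)
    fix e :: real assume "e > 0"
    then obtain N where N: "inverse (real (Suc N)) < e / 2"
      using reals_Archimedean[of "e / 2"] by auto
    have "dist (a m) (a n) < e" if "m \<ge> N" "n \<ge> N" for m n
    proof -
      have "inverse (real (Suc m)) \<le> inverse (real (Suc N))"
        "inverse (real (Suc n)) \<le> inverse (real (Suc N))"
        using that by (auto intro: le_imp_inverse_le)
      then show ?thesis
        using near[of m n] N unfolding dist_norm by linarith
    qed
    then show "\<exists>M. \<forall>m\<ge>M. \<forall>n\<ge>M. dist (a m) (a n) < e" by blast
  qed
  then obtain p where p: "a \<longlonglongrightarrow> p"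
    using Cauchy_convergent_iff convergent_def by blast
  have "(f has_derivative (\<lambda>y. p \<bullet> y)) (at x)"
    unfolding has_derivative_at_alt
  proof (intro conjI allI impI)
    show "bounded_linear ((\<bullet>) p)"
      by (rule bounded_linear_inner_right)
    fix e :: real assume "e > 0"
    then have "\<forall>\<^sub>F n in sequentially. inverse (real (Suc n)) < e / 2"
      using order_tendstoD(2)[OF LIMSEQ_inverse_real_of_nat, of "e / 2"] by simp
    moreover have "\<forall>\<^sub>F n in sequentially. dist (a n) p < e / 2"
      using tendstoD[OF p, of "e / 2"] \<open>e > 0\<close> by simp
    ultimately obtain n where n: "inverse (real (Suc n)) < e / 2" "norm (a n - p) < e / 2"
      using eventually_happens[OF eventually_conj] by (force simp: dist_norm)
    show "\<exists>d>0. \<forall>y. norm (y - x) < d \<longrightarrow> norm (f y - f x - p \<bullet> (y - x)) \<le> e * norm (y - x)"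
    proof (intro exI[of _ "\<rho> n"] conjI allI impI \<rho>)
      fix y assume "norm (y - x) < \<rho> n"
      then have "\<bar>f y - f x - a n \<bullet> (y - x)\<bar> \<le> inverse (real (Suc n)) * norm (y - x)"
        using a[of "y - x" n] by simp
      also have "\<dots> \<le> e / 2 * norm (y - x)"
        using n by (intro mult_right_mono) auto
      finally have "\<bar>f y - f x - a n \<bullet> (y - x)\<bar> \<le> e / 2 * norm (y - x)" .
      moreover have "\<bar>(a n - p) \<bullet> (y - x)\<bar> \<le> e / 2 * norm (y - x)"
        using n by (intro order_trans[OF Cauchy_Schwarz_ineq2] mult_right_mono) auto
      ultimately show "norm (f y - f x - p \<bullet> (y - x)) \<le> e * norm (y - x)"
        unfolding inner_diff_left real_norm_def by linarith
    qed
  qed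
  then show ?thesis
    by (auto simp: differentiable_def)
qed

text \<open>At these points every difference quotient in direction \<open>b\<close> with step at
  most \<open>\<delta>\<close> is within \<open>\<epsilon>\<close> of \<open>q\<close>. Without
  division and with weak inequalities, the set is an intersection of closed sets when
  \<open>f\<close> is continuous.\<close>

definition axis_affine_set :: "('a::euclidean_space \<Rightarrow> real) \<Rightarrow> 'a \<Rightarrow> real \<Rightarrow> real \<Rightarrow> real \<Rightarrow> 'a set"
  where "axis_affine_set f b q \<epsilon> \<delta> =
    {x. \<forall>t. \<bar>t\<bar> \<le> \<delta> \<longrightarrow> \<bar>f (x + t *\<^sub>R b) - f x - t * q\<bar> \<le> \<epsilon> * \<bar>t\<bar>}"

lemma closed_axis_affine_set:
  assumes "continuous_on UNIV f"
  shows "closed (axis_affine_set f b q \<epsilon> \<delta>)"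
proof -
  have "continuous_on UNIV (\<lambda>x. f (x + t *\<^sub>R b))" for t
    by (intro continuous_on_compose2[OF assms] continuous_intros) auto
  then show ?thesis
    unfolding axis_affine_set_def
    by (intro closed_Collect_all closed_Collect_imp closed_Collect_le continuous_intros assms) auto
qed

text \<open>On each line in direction \<open>b\<close> the one-dimensional theorem gives a
  derivative almost everywhere. Approximating it by a rational slope and choosing a scale from a
  sequence leaves countably many sets, which also makes the property Borel.\<close>

lemma lipschitz_AE_axis_affine:
  fixes f :: "'a::euclidean_space \<Rightarrow> real" and L :: real
  assumes lip: "L-lipschitz_on UNIV f" and "\<epsilon> > 0"
  shows "AE x in lborel. \<exists>q\<in>\<rat>. \<exists>m. x \<in> axis_affine_set f b q \<epsilon> (inverse (real (Suc m)))"
proof (rule AE_lborel_if_AE_lines[where v = b])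
  have cont: "continuous_on UNIV f"
    using lip by (rule lipschitz_on_continuous_on)
  have [measurable]: "Measurable.pred borel (\<lambda>x. x \<in> axis_affine_set f b q \<epsilon> \<delta>)" for q \<delta>
    using borel_closed[OF closed_axis_affine_set[OF cont]] by (simp add: pred_def)
  have "countable \<rat>" by (rule countable_rat)
  then show "Measurable.pred borel
      (\<lambda>x. \<exists>q\<in>\<rat>. \<exists>m. x \<in> axis_affine_set f b q \<epsilon> (inverse (real (Suc m))))"
    by measurable
next
  fix x
  have "(L * norm b)-lipschitz_on UNIV (\<lambda>t. f (x + t *\<^sub>R b))"
  proof (rule lipschitz_onI)
    fix s t :: real
    have "dist (f (x + s *\<^sub>R b)) (f (x + t *\<^sub>R b)) \<le> L * dist (x + s *\<^sub>R b) (x + t *\<^sub>R b)"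
      by (rule lipschitz_onD[OF lip]) auto
    also have "dist (x + s *\<^sub>R b) (x + t *\<^sub>R b) = norm b * dist s t"
      by (simp add: dist_norm scaleR_diff_left[symmetric] mult.commute)
    finally show "dist (f (x + s *\<^sub>R b)) (f (x + t *\<^sub>R b)) \<le> L * norm b * dist s t"
      by (simp add: mult.assoc)
  qed (use lipschitz_on_nonneg[OF lip] in simp)
  then have "AE s in lborel. (\<lambda>t. f (x + t *\<^sub>R b)) differentiable (at s)"
    using lipschitz_AE_differentiable_real by (simp add: AE_completion_iff)
  then show "AE s in lborel. \<exists>q\<in>\<rat>. \<exists>m.
      x + s *\<^sub>R b \<in> axis_affine_set f b q \<epsilon> (inverse (real (Suc m)))"
  proof eventually_elim
    case (elim s)
    then obtain D where "((\<lambda>t. f (x + t *\<^sub>R b)) has_real_derivative D) (at s)"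
      by (auto simp: real_differentiable_def)
    then have "((\<lambda>h. (f (x + (s + h) *\<^sub>R b) - f (x + s *\<^sub>R b)) / h) \<longlongrightarrow> D) (at 0)"
      by (simp add: DERIV_def)
    then obtain d where d: "d > 0" "\<And>h. h \<noteq> 0 \<Longrightarrow> \<bar>h\<bar> < d \<Longrightarrow>
        \<bar>(f (x + (s + h) *\<^sub>R b) - f (x + s *\<^sub>R b)) / h - D\<bar> < \<epsilon> / 2"
      using half_gt_zero[OF \<open>\<epsilon> > 0\<close>] unfolding LIM_def dist_real_def by (metis diff_zero)
    \<comment> \<open>Half of \<open>\<epsilon>\<close> pays for replacing \<open>D\<close> by a
      rational number, the other half for the difference quotient.\<close>
    obtain q where q: "q \<in> \<rat>" "D < q" "q < D + \<epsilon> / 2"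
      using Rats_dense_in_real[of D "D + \<epsilon> / 2"] \<open>\<epsilon> > 0\<close> by auto
    obtain m where m: "inverse (real (Suc m)) < d"
      using reals_Archimedean[OF d(1)] by blast
    have "\<bar>f (x + s *\<^sub>R b + h *\<^sub>R b) - f (x + s *\<^sub>R b) - h * q\<bar> \<le> \<epsilon> * \<bar>h\<bar>"
      if h: "\<bar>h\<bar> \<le> inverse (real (Suc m))" for h
    proof (cases "h = 0")
      case False
      let ?Q = "(f (x + (s + h) *\<^sub>R b) - f (x + s *\<^sub>R b)) / h"
      have "\<bar>?Q - q\<bar> \<le> \<epsilon>"
        using d(2)[OF False] h m q by linarith
      then have "\<bar>?Q - q\<bar> * \<bar>h\<bar> \<le> \<epsilon> * \<bar>h\<bar>"
        by (intro mult_right_mono) auto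
      also have "\<bar>?Q - q\<bar> * \<bar>h\<bar> = \<bar>(?Q - q) * h\<bar>"
        by (rule abs_mult[symmetric])
      also have "(?Q - q) * h = ?Q * h - h * q"
        by (simp add: left_diff_distrib mult.commute[of q h])
      also have "\<dots> = f (x + s *\<^sub>R b + h *\<^sub>R b) - f (x + s *\<^sub>R b) - h * q"
        using False by (simp add: scaleR_add_left add.assoc)
      finally show ?thesis .
    qed simp
    then show ?case
      using q(1) unfolding axis_affine_set_def by blast
  qed
qed

text \<open>The path from \<open>x\<close> to \<open>x + y\<close> changes one coordinate at a time.
  Each edge is translated to start at a nearby point \<open>z\<close> of \<open>S\<close>: the
  translation costs at most \<open>L * \<eta> * norm y\<close> at either end, and the edge from
  \<open>z\<close> costs \<open>\<epsilon> * norm y\<close>. Summing over the coordinates gives the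
  bound.\<close>

lemma approx_linear_if_nearby_axis_affine:
  fixes f :: "'a::euclidean_space \<Rightarrow> real" and L :: real
  assumes lip: "L-lipschitz_on UNIV f" and "\<epsilon> \<ge> 0" and "\<delta> > 0" and "\<eta> \<ge> 0"
    and S: "\<And>z b. \<lbrakk>z \<in> S; b \<in> Basis\<rbrakk> \<Longrightarrow> z \<in> axis_affine_set f b (a \<bullet> b) \<epsilon> \<delta>"
    and "\<rho> > 0"
    and near: "\<And>y. norm y < \<rho> \<Longrightarrow> \<exists>z\<in>S. dist (x + y) z \<le> \<eta> * norm y"
    and y: "norm y < min \<rho> \<delta>"
  shows "\<bar>f (x + y) - f x - a \<bullet> y\<bar> \<le> DIM('a) * (\<epsilon> + 2 * L * \<eta>) * norm y"
proof -
  have "L \<ge> 0"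
    using lip by (rule lipschitz_on_nonneg)
  have L: "\<bar>f u - f v\<bar> \<le> L * dist u v" for u v
    using lipschitz_onD[OF lip, of u v] by (simp add: dist_real_def)
  define Y where "Y = (\<lambda>B. \<Sum>b\<in>B. (y \<bullet> b) *\<^sub>R b)"
  have step: "\<bar>f (x + Y B) - f x - a \<bullet> Y B\<bar> \<le> card B * (\<epsilon> + 2 * L * \<eta>) * norm y"
    if "finite B" "B \<subseteq> Basis" for B
    using that
  proof (induction B)
    case (insert b B)
    let ?t = "y \<bullet> b" and ?w = "x + Y B"
    have b: "b \<in> Basis" "b \<notin> B" using insert by auto
    \<comment> \<open>No corner is farther from \<open>x\<close> than \<open>x + y\<close> is, so
      \<open>near\<close> applies at every corner.\<close>
    have "norm (Y B) \<le> norm y"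
    proof (rule norm_le_componentwise)
      fix i :: 'a assume i: "i \<in> Basis"
      have "Y B \<bullet> i = (\<Sum>c\<in>B. if c = i then y \<bullet> i else 0)"
        unfolding Y_def inner_sum_left
        by (rule sum.cong) (use insert.prems i in \<open>auto simp: inner_Basis\<close>)
      then show "\<bar>Y B \<bullet> i\<bar> \<le> \<bar>y \<bullet> i\<bar>"
        using insert.hyps(1) by simp
    qed
    then have "norm (Y B) < \<rho>" "\<eta> * norm (Y B) \<le> \<eta> * norm y"
      using y \<open>\<eta> \<ge> 0\<close> by (auto intro: mult_left_mono)
    then obtain z where z: "z \<in> S" "dist ?w z \<le> \<eta> * norm y"
      using near[of "Y B"] by fastforce
    have t: "\<bar>?t\<bar> \<le> norm y"
      using b(1) by (simp add: Basis_le_norm)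
    have "\<bar>f (z + ?t *\<^sub>R b) - f z - ?t * (a \<bullet> b)\<bar> \<le> \<epsilon> * \<bar>?t\<bar>"
      using S[OF z(1) b(1)] t y unfolding axis_affine_set_def by auto
    also have "\<dots> \<le> \<epsilon> * norm y"
      using t \<open>\<epsilon> \<ge> 0\<close> by (rule mult_left_mono)
    finally have 1: "\<bar>f (z + ?t *\<^sub>R b) - f z - ?t * (a \<bullet> b)\<bar> \<le> \<epsilon> * norm y" .
    have Lz: "L * dist ?w z \<le> L * \<eta> * norm y"
      using mult_left_mono[OF z(2) \<open>L \<ge> 0\<close>] by (simp add: mult.assoc)
    have 2: "\<bar>f ?w - f z\<bar> \<le> L * \<eta> * norm y"
      using L[of ?w z] Lz by linarith
    have 3: "\<bar>f (?w + ?t *\<^sub>R b) - f (z + ?t *\<^sub>R b)\<bar> \<le> L * \<eta> * norm y"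
      using L[of "?w + ?t *\<^sub>R b" "z + ?t *\<^sub>R b"] Lz by simp
    have IH: "\<bar>f ?w - f x - a \<bullet> Y B\<bar> \<le> card B * (\<epsilon> + 2 * L * \<eta>) * norm y"
      using insert by simp
    have Y: "x + Y (insert b B) = ?w + ?t *\<^sub>R b" "a \<bullet> Y (insert b B) = a \<bullet> Y B + ?t * (a \<bullet> b)"
      using insert.hyps by (simp_all add: Y_def inner_add_right)
    have "\<bar>f (x + Y (insert b B)) - f x - a \<bullet> Y (insert b B)\<bar>
        \<le> card B * (\<epsilon> + 2 * L * \<eta>) * norm y + (\<epsilon> * norm y + 2 * (L * \<eta> * norm y))"
      using 1 2 3 IH unfolding Y by linarith
    also have "\<dots> = card (insert b B) * (\<epsilon> + 2 * L * \<eta>) * norm y"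
      using insert.hyps by (simp add: algebra_simps)
    finally show ?case .
  qed (simp add: Y_def)
  have "Y Basis = y"
    unfolding Y_def by (rule euclidean_representation)
  then show ?thesis
    using step[of Basis] by simp
qed

lemma lipschitz_AE_differentiable_scalar:
  fixes f :: "'a::euclidean_space \<Rightarrow> real" and L :: real
  assumes lip: "L-lipschitz_on UNIV f"
  shows "AE x in lebesgue. f differentiable (at x)"
proof -
  have cont: "continuous_on UNIV f"
    using lip by (rule lipschitz_on_continuous_on)
  have "L \<ge> 0"
    using lip by (rule lipschitz_on_nonneg)
  define r where "r n = inverse (real (Suc n))" for n
  have r_pos: "r n > 0" for n by (simp add: r_def)
  define S where "S q k m = (\<Inter>b\<in>Basis. axis_affine_set f b (q b) (r k) (r m))" for q k m
  \<comment> \<open>Extensional functions on the finite basis keep the set of rational slope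
    assignments countable, so a single null set serves all parameters.\<close>
  define Q where "Q = (Basis :: 'a set) \<rightarrow>\<^sub>E (\<rat> :: real set)"
  have "countable Q"
    unfolding Q_def by (intro countable_PiE countable_rat) auto
  have "AE x in lebesgue. \<exists>q\<in>\<rat>. \<exists>m. x \<in> axis_affine_set f b q (r k) (r m)" for b k
    using lipschitz_AE_axis_affine[OF lip r_pos] by (simp add: AE_completion r_def)
  then have axis: "AE x in lebesgue. \<forall>k. \<forall>b\<in>Basis. \<exists>q\<in>\<rat>. \<exists>m. x \<in> axis_affine_set f b q (r k) (r m)"
    by (simp add: AE_all_countable AE_finite_all)
  have "closed (S q k m)" for q k m
    unfolding S_def using closed_axis_affine_set[OF cont] by blast
  then have near: "AE x in lebesgue. \<forall>q\<in>Q. \<forall>k m j. x \<in> S q k m \<longrightarrow>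
      (\<exists>\<rho>>0. \<forall>y. norm y < \<rho> \<longrightarrow> (\<exists>z\<in>S q k m. dist (x + y) z \<le> r j * norm y))"
    unfolding AE_all_countable AE_ball_countable[OF \<open>countable Q\<close>]
    by (intro ballI allI closed_AE_nearby_points r_pos)
  from axis near show ?thesis
  proof eventually_elim
    case (elim x)
    show ?case
    proof (rule differentiable_if_approx_linear)
      fix e :: real assume "e > 0"
      \<comment> \<open>With \<open>r k\<close> as both the slope tolerance and the relative
        distance to the set, the path estimate has constant
        \<open>DIM('a) * (1 + 2 * L) * r k\<close>, which \<open>d\<close> keeps below
        \<open>e\<close>.\<close>
      define d where "d = e / (DIM('a) * (1 + 2 * L))"
      have "d > 0"
        using \<open>e > 0\<close> \<open>L \<ge> 0\<close> by (simp add: d_def)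
      then obtain k where k: "r k < d"
        using reals_Archimedean unfolding r_def by blast
      have "\<forall>b\<in>Basis. \<exists>q. q \<in> \<rat> \<and> (\<exists>m. x \<in> axis_affine_set f b q (r k) (r m))"
        using elim(1) by blast
      then obtain q0 m0 where q0: "\<And>b. b \<in> Basis \<Longrightarrow> q0 b \<in> \<rat>"
          and m0: "\<And>b. b \<in> Basis \<Longrightarrow> x \<in> axis_affine_set f b (q0 b) (r k) (r (m0 b))"
        by metis
      define q where "q = restrict q0 Basis"
      \<comment> \<open>The largest index gives the smallest scale, which is valid for all axes at
        once.\<close>
      define m where "m = Max (m0 ` Basis)"
      have "q \<in> Q"
        using q0 by (simp add: Q_def q_def)
      have "r m \<le> r (m0 b)" if "b \<in> Basis" for b
        using that by (simp add: r_def m_def)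
      then have "x \<in> S q k m"
        using m0 by (fastforce simp: S_def q_def axis_affine_set_def)
      then obtain \<rho> where \<rho>: "\<rho> > 0"
          "\<And>y. norm y < \<rho> \<Longrightarrow> \<exists>z\<in>S q k m. dist (x + y) z \<le> r k * norm y"
        using elim(2) \<open>q \<in> Q\<close> by blast
      define a where "a = (\<Sum>b\<in>Basis. q b *\<^sub>R b)"
      have a: "a \<bullet> b = q b" if "b \<in> Basis" for b
        using that by (simp add: a_def)
      have "\<bar>f (x + y) - f x - a \<bullet> y\<bar> \<le> e * norm y" if "norm y < min \<rho> (r m)" for y
      proof -
        have "\<bar>f (x + y) - f x - a \<bullet> y\<bar> \<le> DIM('a) * (r k + 2 * L * r k) * norm y"
          by (rule approx_linear_if_nearby_axis_affine[OF lip _ r_pos _ _ \<rho> that])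
             (auto simp: S_def a less_imp_le[OF r_pos])
        also have "DIM('a) * (r k + 2 * L * r k) = DIM('a) * (1 + 2 * L) * r k"
          by (simp add: algebra_simps)
        also have "\<dots> \<le> DIM('a) * (1 + 2 * L) * d"
          using k \<open>L \<ge> 0\<close> by (intro mult_left_mono) auto
        also have "\<dots> = e"
          using \<open>L \<ge> 0\<close> by (simp add: d_def)
        finally show ?thesis
          by (simp add: mult_right_mono)
      qed
      then show "\<exists>a. \<exists>\<rho>>0. \<forall>y. norm y < \<rho> \<longrightarrow> \<bar>f (x + y) - f x - a \<bullet> y\<bar> \<le> e * norm y"
        using \<rho>(1) r_pos by (intro exI[of _ a] exI[of _ "min \<rho> (r m)"]) auto
    qed
  qed
qed

lemma lipschitz_AE_differentiable:
  fixes f :: "'a::euclidean_space \<Rightarrow> 'b::euclidean_space"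
  assumes lip: "L-lipschitz_on UNIV f"
  shows "AE x in lebesgue. f differentiable (at x)"
proof -
  have "L-lipschitz_on UNIV (\<lambda>x. f x \<bullet> i)" if "i \<in> Basis" for i
  proof (rule lipschitz_onI)
    fix x y
    have "\<bar>(f x - f y) \<bullet> i\<bar> \<le> dist (f x) (f y)"
      using that by (simp add: Basis_le_norm dist_norm)
    also have "\<dots> \<le> L * dist x y"
      using lipschitz_onD[OF lip] by simp
    finally show "dist (f x \<bullet> i) (f y \<bullet> i) \<le> L * dist x y"
      by (simp add: dist_real_def inner_diff_left)
  qed (rule lipschitz_on_nonneg[OF lip])
  then have "AE x in lebesgue. \<forall>i\<in>Basis. (\<lambda>x. f x \<bullet> i) differentiable (at x)"
    unfolding AE_finite_all[OF finite_Basis] by (intro ballI lipschitz_AE_differentiable_scalar)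
  then show ?thesis
    by (subst differentiable_componentwise_within)
qed

subsection \<open>The regularized minimizer\<close>

lemma reg_objective_eq_dist:
  assumes "\<gamma> > 0"
  shows "reg_objective \<gamma> y z =
    \<gamma> / 2 * (dist (- (y /\<^sub>R \<gamma>)) z)\<^sup>2 - (norm y)\<^sup>2 / (2 * \<gamma>)"
proof -
  have "(norm (z + y /\<^sub>R \<gamma>))\<^sup>2 = (norm z)\<^sup>2 + 2 * (y \<bullet> z) / \<gamma> + (norm y)\<^sup>2 / \<gamma>\<^sup>2"
    unfolding power2_norm_eq_inner inner_add_left inner_add_right inner_scaleR_left inner_scaleR_right
      inner_commute[of z y]
    by (simp add: divide_inverse power2_eq_square distrib_left)
  then have "\<gamma> / 2 * (norm (z + y /\<^sub>R \<gamma>))\<^sup>2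
      = \<gamma> / 2 * (norm z)\<^sup>2 + y \<bullet> z + (norm y)\<^sup>2 / (2 * \<gamma>)"
    using assms by (simp add: distrib_left power2_eq_square[of \<gamma>])
  moreover have "dist (- (y /\<^sub>R \<gamma>)) z = norm (z + y /\<^sub>R \<gamma>)"
    unfolding dist_norm by (subst norm_minus_cancel[symmetric]) (simp add: add.commute)
  ultimately show ?thesis
    unfolding reg_objective_def by (metis add_diff_cancel_right' add.commute)
qed

text \<open>The modulus is \<open>\<gamma>\<close>, with equality: the linear term cancels, and
  expanding the squared norm of a convex combination leaves exactly the quadratic
  correction.\<close>

lemma strongly_convex_on_reg_objective:
  fixes y :: "real ^ 'd"
  assumes "\<gamma> > 0"
  shows "strongly_convex_on UNIV (reg_objective \<gamma> y)"
  unfolding strongly_convex_on_def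
proof (intro conjI exI[of _ \<gamma>] ballI)
  fix x z :: "real ^ 'd" and t :: real
  define u where "u = (1 - t) *\<^sub>R x + t *\<^sub>R z"
  have "u \<bullet> u = (1 - t) * (1 - t) * (x \<bullet> x) + 2 * (t * (1 - t)) * (x \<bullet> z) + t * t * (z \<bullet> z)"
    unfolding u_def inner_add_left inner_add_right inner_scaleR_left inner_scaleR_right inner_commute[of z x]
    by algebra
  moreover have "y \<bullet> u = (1 - t) * (y \<bullet> x) + t * (y \<bullet> z)"
    by (simp add: u_def inner_add_right)
  moreover have "(x - z) \<bullet> (x - z) = x \<bullet> x - 2 * (x \<bullet> z) + z \<bullet> z"
    by (simp add: inner_diff_left inner_diff_right inner_commute[of z x])
  ultimately have "reg_objective \<gamma> y u = (1 - t) * reg_objective \<gamma> y x + t * reg_objective \<gamma> y z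
        - \<gamma> / 2 * t * (1 - t) * (norm (x - z))\<^sup>2"
    unfolding reg_objective_def power2_norm_eq_inner by algebra
  then show "reg_objective \<gamma> y ((1 - t) *\<^sub>R x + t *\<^sub>R z)
      \<le> (1 - t) * reg_objective \<gamma> y x + t * reg_objective \<gamma> y z
        - \<gamma> / 2 * t * (1 - t) * (norm (x - z))\<^sup>2"
    by (simp add: u_def)
qed (simp_all add: assms)

text \<open>By \<open>reg_objective_eq_dist\<close> the objective orders points exactly as their
  distance to \<open>- (y /\<^sub>R \<gamma>)\<close> does. Existence and uniqueness of the
  minimizer are thus those of the closest point in a closed convex set.\<close>

lemma is_arg_min_reg_objective_iff:
  assumes "\<gamma> > 0" and "Z \<noteq> {}" and "closed Z" and "convex Z"
  shows "is_arg_min (reg_objective \<gamma> y) (\<lambda>z. z \<in> Z) z \<longleftrightarrow> z = closest_point Z (- (y /\<^sub>R \<gamma>))"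
proof -
  let ?c = "- (y /\<^sub>R \<gamma>)"
  have le: "reg_objective \<gamma> y u \<le> reg_objective \<gamma> y v \<longleftrightarrow> dist ?c u \<le> dist ?c v" for u v
    using assms(1) by (simp add: reg_objective_eq_dist power_mono_iff)
  have "is_arg_min (reg_objective \<gamma> y) (\<lambda>z. z \<in> Z) z \<longleftrightarrow>
      z \<in> Z \<and> (\<forall>u\<in>Z. dist ?c z \<le> dist ?c u)"
    unfolding is_arg_min_linorder le by auto
  also have "\<dots> \<longleftrightarrow> z = closest_point Z ?c"
    using closest_point_unique[OF \<open>convex Z\<close> \<open>closed Z\<close>]
      closest_point_exists[OF \<open>closed Z\<close> \<open>Z \<noteq> {}\<close>] by blast
  finally show ?thesis .
qed

text \<open>The projection is nonexpansive, so the constant is that of the scaling by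
  \<open>- 1 / \<gamma>\<close>.\<close>

lemma lipschitz_on_closest_point_scaled:
  fixes Z :: "'a::euclidean_space set"
  assumes "\<gamma> > 0" and "Z \<noteq> {}" and "closed Z" and "convex Z"
  shows "(1 / \<gamma>)-lipschitz_on UNIV (\<lambda>y. closest_point Z (- (y /\<^sub>R \<gamma>)))"
proof (rule lipschitz_onI)
  fix x y :: 'a
  have "dist (closest_point Z (- (x /\<^sub>R \<gamma>))) (closest_point Z (- (y /\<^sub>R \<gamma>)))
      \<le> dist (- (x /\<^sub>R \<gamma>)) (- (y /\<^sub>R \<gamma>))"
    using assms by (intro closest_point_lipschitz)
  also have "\<dots> = 1 / \<gamma> * dist x y"
    using assms(1) by
      (simp add: dist_minus dist_norm divide_inverse norm_minus_commute[of y x] flip: scaleR_diff_right)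
  finally show "dist (closest_point Z (- (x /\<^sub>R \<gamma>))) (closest_point Z (- (y /\<^sub>R \<gamma>)))
      \<le> 1 / \<gamma> * dist x y" .
qed (use assms in simp)

theorem lemma1:
  fixes \<gamma> :: real and Z :: "(real ^ 'd) set"
  assumes "\<gamma> > 0"
    and "Z \<noteq> {}" and "compact Z" and "convex Z"
  shows "(\<forall>y\<^sub>0 :: real ^ 'd.
            strongly_convex_on UNIV (reg_objective \<gamma> y\<^sub>0) \<and>
            (\<exists>!z. is_arg_min (reg_objective \<gamma> y\<^sub>0) (\<lambda>z. z \<in> Z) z) \<and>
            reg_minimizer \<gamma> Z y\<^sub>0 = closest_point Z (- (y\<^sub>0 /\<^sub>R \<gamma>))) \<and>
         (1 / \<gamma>)-lipschitz_on UNIV (reg_minimizer \<gamma> Z) \<and>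
         (AE y in lebesgue. reg_minimizer \<gamma> Z differentiable (at y))"
proof (intro conjI allI)
  have proj: "is_arg_min (reg_objective \<gamma> y) (\<lambda>z. z \<in> Z) z \<longleftrightarrow> z = closest_point Z (- (y /\<^sub>R \<gamma>))"
    for y z
    using assms by (intro is_arg_min_reg_objective_iff compact_imp_closed)
  then show "\<exists>!z. is_arg_min (reg_objective \<gamma> y) (\<lambda>z. z \<in> Z) z" for y
    by simp
  \<comment> \<open>By \<open>proj\<close> the Hilbert choice ranges over a single point, so it
    returns the projection.\<close>
  show min: "reg_minimizer \<gamma> Z y = closest_point Z (- (y /\<^sub>R \<gamma>))" for y
    unfolding reg_minimizer_def arg_min_on_def arg_min_def proj by simp
  show lip: "(1 / \<gamma>)-lipschitz_on UNIV (reg_minimizer \<gamma> Z)"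
    unfolding min[abs_def] using assms by (intro lipschitz_on_closest_point_scaled compact_imp_closed)
  show "AE y in lebesgue. reg_minimizer \<gamma> Z differentiable (at y)"
    using lip by (rule lipschitz_AE_differentiable)
qed (rule strongly_convex_on_reg_objective[OF assms(1)])

end
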